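(* Let $m\ge2$. The limit $p_\bot(m):=\lim_{n\to\infty}g_n^{(0)}/g_n$ equals $$p_\bot(m)=\frac12\left(1-\sqrt{\frac{m}{m+4}}\right).$$ In particular $p_\bot(m)\sim\frac1m$ as $m\to\infty$.
   Context: For an integer $m\ge2$ let $V_m=\{v_0<v_1<\cdots<v_{m-1}\}$ ($v_0=0$, $v_{m-1}=1$) be an $m$-element chain with Gödel implication $v_p\Rightarrow_G v_q=v_{m-1}$ if $p\le q$ and $v_p\Rightarrow_G v_q=v_q$ if $p>q$. For $n\ge1$, consider the $C_{n-1}$ full bracketings of $p_1\Rightarrow_G\cdots\Rightarrow_G p_n$ in $n$ distinct variables (full binary trees with $n$ ordered leaves), $C_k$ being the Catalan numbers. Let $g_n^{(j)}$ be the number of pairs (bracketing, valuation $\{p_1,\dots,p_n\}\to V_m$) for which the bracketed formula evaluates to $v_j$, and $g_n=\sum_{j=0}^{m-1}g_n^{(j)}=m^nC_{n-1}$. *)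

theory Defs
  imports Complex_Main "HOL-Library.FuncSet" "HOL-Library.Landau_Symbols"
begin

text \<open>
  The \<open>m\<close>-element chain \<open>v\<^sub>0 < v\<^sub>1 < \<dots> < v\<^sub>m\<^sub>-\<^sub>1\<close> is represented by its indices
  \<open>{..<m}\<close> with the usual order: the number \<open>j\<close> stands for \<open>v\<^sub>j\<close>, so the bottom is \<open>0\<close>
  and the top is \<open>m - 1\<close>.
\<close>

definition godel_imp :: "nat \<Rightarrow> nat \<Rightarrow> nat \<Rightarrow> nat" where
  "godel_imp m p q = (if p \<le> q then m - 1 else q)"

datatype formula = Var nat | Imp formula formula

primrec vars :: "formula \<Rightarrow> nat list" where
  "vars (Var i) = [i]"
| "vars (Imp \<phi> \<psi>) = vars \<phi> @ vars \<psi>"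

primrec eval :: "nat \<Rightarrow> (nat \<Rightarrow> nat) \<Rightarrow> formula \<Rightarrow> nat" where
  "eval m a (Var i) = a i"
| "eval m a (Imp \<phi> \<psi>) = godel_imp m (eval m a \<phi>) (eval m a \<psi>)"

text \<open>
  The full bracketings of \<open>p\<^sub>1 \<Rightarrow> \<dots> \<Rightarrow> p\<^sub>n\<close> are the formulas whose variables, read from left
  to right, are \<open>1, \<dots>, n\<close>.
\<close>

definition bracketings :: "nat \<Rightarrow> formula set" where
  "bracketings n = {\<phi>. vars \<phi> = [1..<Suc n]}"

text \<open>
  Taking valuations in the extensional function space makes each map
  \<open>{1..n} \<rightarrow> {..<m}\<close> count exactly once.
\<close>

definition g :: "nat \<Rightarrow> nat \<Rightarrow> nat \<Rightarrow> nat" where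
  "g m n j = card {(\<phi>, a). \<phi> \<in> bracketings n \<and> a \<in> {1..n} \<rightarrow>\<^sub>E {..<m} \<and> eval m a \<phi> = j}"

definition g_total :: "nat \<Rightarrow> nat \<Rightarrow> nat" where
  "g_total m n = (\<Sum>j<m. g m n j)"

definition p_bot :: "nat \<Rightarrow> real" where
  "p_bot m = lim (\<lambda>n. real (g m n 0) / real (g_total m n))"

text \<open>The sets counted by \<^const>\<open>g\<close> are finite, so \<^const>\<open>card\<close> is the true number of pairs.\<close>

lemma vars_nonempty: "vars \<phi> \<noteq> []"
  by (induction \<phi>) auto

lemma finite_vars_eq: "finite {\<phi>. vars \<phi> = xs}"
proof (induction xs rule: length_induct)
  case (1 xs)
  let ?S = "\<lambda>ys. {\<phi>. vars \<phi> = ys}"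
  let ?I = "{k. 0 < k \<and> k < length xs}"
  have "?S xs \<subseteq> Var ` set xs \<union> (\<Union>k\<in>?I. (\<lambda>(\<phi>, \<psi>). Imp \<phi> \<psi>) ` (?S (take k xs) \<times> ?S (drop k xs)))"
  proof
    fix \<phi> assume "\<phi> \<in> ?S xs"
    then have "vars \<phi> = xs" by simp
    then show "\<phi> \<in> Var ` set xs \<union>
      (\<Union>k\<in>?I. (\<lambda>(\<phi>, \<psi>). Imp \<phi> \<psi>) ` (?S (take k xs) \<times> ?S (drop k xs)))"
    proof (cases \<phi>)
      case (Imp \<alpha> \<beta>)
      with \<open>vars \<phi> = xs\<close> have "xs = vars \<alpha> @ vars \<beta>" by simp
      then have "length (vars \<alpha>) \<in> ?I"
        and "\<phi> \<in> (\<lambda>(\<phi>, \<psi>). Imp \<phi> \<psi>) `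
          (?S (take (length (vars \<alpha>)) xs) \<times> ?S (drop (length (vars \<alpha>)) xs))"
        using Imp vars_nonempty[of \<alpha>] vars_nonempty[of \<beta>]
        by (auto intro!: image_eqI[of _ _ "(\<alpha>, \<beta>)"])
      then show ?thesis by blast
    qed auto
  qed
  moreover have "finite (?S (take k xs))" "finite (?S (drop k xs))" if "k \<in> ?I" for k
    using 1 that by auto
  ultimately show ?case
    by (auto elim!: finite_subset)
qed

lemma finite_bracketings: "finite (bracketings n)"
  unfolding bracketings_def by (rule finite_vars_eq)

lemma finite_pairs:
  "finite {(\<phi>, a). \<phi> \<in> bracketings n \<and> a \<in> {1..n} \<rightarrow>\<^sub>E {..<m} \<and> eval m a \<phi> = j}"
proof (rule finite_subset)
  show "finite (bracketings n \<times> ({1..n} \<rightarrow>\<^sub>E {..<m}))"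
    by (intro finite_cartesian_product finite_bracketings finite_PiE) auto
qed auto

end

theory Submission
  imports Defs "HOL-Computational_Algebra.Formal_Power_Series" "HOL-Real_Asymp.Real_Asymp"
begin

text \<open>
  Let \<open>G\<close> and \<open>A\<close> be the generating functions of all pairs and of the pairs with value \<open>0\<close>. An
  implication has value \<open>0\<close> iff its conclusion does and its premise does not, so
  \<open>G = m x + G\<^sup>2\<close> and \<open>A = x + (G - A) A\<close>. Both have their singularity at \<open>\<rho> = 1 / (4 m)\<close>, and
  \<open>D = A + (1 - G) / 2\<close> satisfies \<open>D\<^sup>2 = x + (1 - G)\<^sup>2 / 4\<close>. Instead of singularity analysis,
  the limit of the coefficient ratios of \<open>D\<close> and \<open>G\<close> is read off the convolution recurrence for
  \<open>D\<^sup>2\<close>: only the summands near the two ends of the convolution matter, each end contributes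
  the sum of the coefficients of \<open>D\<close> at \<open>\<rho>\<close> times the ratio, and the resulting linear
  fixed-point equation contracts errors because \<open>2 \<Sum>|d\<^sub>k| \<le> G(\<rho>) = 1 / 2\<close>, where the
  \<open>d\<^sub>k\<close> are the nonconstant coefficients of \<open>D\<close> scaled by \<open>\<rho>\<^sup>k\<close>.
\<close>

section \<open>Coefficient ratios from a convolution recurrence\<close>

text \<open>The reflection \<open>k \<mapsto> n - k\<close> carries the last \<open>K\<close>
  indices to the first \<open>K\<close>, so both ends of a convolution contribute equally.\<close>

lemma sum_symmetric_split:
  fixes h :: "nat \<Rightarrow> real"
  assumes sym: "\<And>k. k \<le> n \<Longrightarrow> h (n - k) = h k" and "2 * K \<le> n"
  shows "(\<Sum>k\<le>n. h k) = 2 * (\<Sum>k<K. h k) + (\<Sum>k = K..n - K. h k)"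
proof -
  have "{..n} = {..<K} \<union> ({K..n - K} \<union> {n - K<..n})" using assms(2) by auto
  also have "sum h \<dots> = (\<Sum>k<K. h k) + ((\<Sum>k = K..n - K. h k) + (\<Sum>k\<in>{n - K<..n}. h k))"
    using assms(2) by (subst sum.union_disjoint; (subst sum.union_disjoint)?) auto
  also have "(\<Sum>k\<in>{n - K<..n}. h k) = (\<Sum>k<K. h k)"
    by (rule sum.reindex_bij_witness[of _ "\<lambda>k. n - k" "\<lambda>k. n - k"]) (use assms in auto)
  finally show ?thesis by simp
qed

text \<open>The quotient is a telescoping product of \<open>k\<close> consecutive ratios, each
  tending to 1. Since \<open>w 0\<close> may vanish, cancellation is only available from index 1
  on.\<close>

lemma shifted_ratio_tendsto:
  fixes w :: "nat \<Rightarrow> real"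
  assumes pos: "\<And>n. 1 \<le> n \<Longrightarrow> 0 < w n"
    and ratio: "(\<lambda>n. w n / w (Suc n)) \<longlonglongrightarrow> 1"
  shows "(\<lambda>n. w (n - k) / w n) \<longlonglongrightarrow> 1"
proof -
  have "(\<lambda>n. w n / w (n + k)) \<longlonglongrightarrow> 1"
  proof (induction k)
    case 0
    have "eventually (\<lambda>n. w n / w n = 1) sequentially"
      using eventually_ge_at_top[of 1] by eventually_elim (use pos in force)
    then show ?case by (simp add: tendsto_eventually)
  next
    case (Suc k)
    have lim: "(\<lambda>n. w n / w (n + k) * (w (n + k) / w (Suc (n + k)))) \<longlonglongrightarrow> 1 * 1"
      by (intro tendsto_mult Suc LIMSEQ_ignore_initial_segment[OF ratio])
    have eq: "eventually (\<lambda>n. w n / w (n + k) * (w (n + k) / w (Suc (n + k)))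
        = w n / w (n + Suc k)) sequentially"
      using eventually_ge_at_top[of 1]
    proof eventually_elim
      case (elim n)
      then show ?case using pos[of "n + k"] by simp
    qed
    show ?case using Lim_transform_eventually[OF lim eq] by simp
  qed
  then have "(\<lambda>n. w (n + k - k) / w (n + k)) \<longlonglongrightarrow> 1" by simp
  then show ?thesis by (rule LIMSEQ_offset)
qed

text \<open>If \<open>d n / w n\<close> has a limit \<open>L\<close>, the two ends of the
  convolution force \<open>L = - 1 / 4 - 2 * S * L\<close>. Convergence itself comes from bounding
  the error \<open>e\<close> by a contraction. Since \<open>w\<close> sums to exactly
  \<open>1 / 2\<close>, the ends exhaust the convolution of \<open>w\<close> asymptotically, and
  domination makes the middle part negligible for \<open>d\<close> too.\<close>

lemma convolution_ratio_tendsto: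
  fixes w d :: "nat \<Rightarrow> real"
  assumes w_pos: "\<And>n. 1 \<le> n \<Longrightarrow> 0 < w n"
    and w_conv: "\<And>n. 2 \<le> n \<Longrightarrow> (\<Sum>k\<le>n. w k * w (n - k)) = w n"
    and w_ratio: "(\<lambda>n. w n / w (Suc n)) \<longlonglongrightarrow> 1"
    and w_sums: "w sums (1 / 2)"
    and d_le: "\<And>n. \<bar>d n\<bar> \<le> w n / 2"
    and d_conv: "\<And>n. 2 \<le> n \<Longrightarrow> d n = - w n / 4 - (\<Sum>k\<le>n. d k * d (n - k))"
    and d_sums: "d sums S"
    and S: "0 < 1 + 2 * S"
  shows "(\<lambda>n. d n / w n) \<longlonglongrightarrow> - 1 / (4 * (1 + 2 * S))"
proof -
  define L where "L = - 1 / (4 * (1 + 2 * S))"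
  define e where "e n = d n / w n - L" for n
  have L: "L = - 1 / 4 - 2 * S * L"
    using S by (simp add: L_def field_simps)
  have w_nonneg: "0 \<le> w n" for n using d_le[of n] by linarith
  define q where "q n k = w (n - k) / w n" for n k
  have q_nonneg: "0 \<le> q n k" for n k using w_nonneg by (simp add: q_def)
  have q_lim: "(\<lambda>n. q n k) \<longlonglongrightarrow> 1" for k
    unfolding q_def by (rule shifted_ratio_tendsto[OF w_pos w_ratio])
  \<comment> \<open>The three summands bound, in turn: replacing the truncated weighted sum of
    \<open>d\<close> by \<open>S\<close>, the errors of the ratios at \<open>n - k\<close> for
    \<open>k < K\<close>, and the middle part of the convolution.\<close>
  define R where "R b K n = 2 * \<bar>L\<bar> * \<bar>S - (\<Sum>k<K. d k * q n k)\<bar>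
      + b * (\<Sum>k<K. w k * q n k) + 1 / 4 * (1 - 2 * (\<Sum>k<K. w k * q n k))" for b K n
  have e_le: "\<bar>e n\<bar> \<le> R b K n"
    if n: "2 \<le> n" "2 * K < n" and b0: "0 \<le> b" and b: "\<And>k. k < K \<Longrightarrow> \<bar>e (n - k)\<bar> \<le> b" for n K b
  proof -
    have wn: "0 < w n" using w_pos n by simp
    define M where "M = (\<Sum>k = K..n - K. d k * d (n - k))"
    define W where "W = (\<Sum>k = K..n - K. w k * w (n - k))"
    have W: "w n = 2 * (\<Sum>k<K. w k * w (n - k)) + W"
      unfolding W_def using w_conv[of n] n
      by (subst sum_symmetric_split[symmetric]) (auto simp: mult.commute)
    have M: "d n = - w n / 4 - (2 * (\<Sum>k<K. d k * d (n - k)) + M)"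
      unfolding M_def using d_conv[of n] n
      by (subst sum_symmetric_split[symmetric]) (auto simp: mult.commute)
    \<comment> \<open>Each factor is at most half its counterpart in \<open>w\<close>, which makes
      the middle part of \<open>d\<close> at most a quarter of that of \<open>w\<close>.\<close>
    have "\<bar>M\<bar> \<le> (\<Sum>k = K..n - K. \<bar>d k * d (n - k)\<bar>)"
      unfolding M_def by (rule sum_abs)
    also have "\<dots> \<le> (\<Sum>k = K..n - K. w k / 2 * (w (n - k) / 2))"
      unfolding abs_mult by (intro sum_mono mult_mono d_le) (auto simp: w_nonneg)
    also have "\<dots> = W / 4"
      by (simp add: W_def sum_divide_distrib)
    finally have "\<bar>M / w n\<bar> \<le> 1 / 4 * (W / w n)"
      using wn by (simp add: field_simps)
    also have "W / w n = 1 - 2 * (\<Sum>k<K. w k * q n k)"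
    proof -
      have "W = w n - 2 * (\<Sum>k<K. w k * w (n - k))" using W by simp
      then show ?thesis
        using wn by (simp add: q_def diff_divide_distrib sum_divide_distrib[symmetric])
    qed
    finally have M_le: "\<bar>M / w n\<bar> \<le> 1 / 4 * (1 - 2 * (\<Sum>k<K. w k * q n k))" .
    have d_eq: "d (n - k) / w n = (L + e (n - k)) * q n k" if "k < K" for k
    proof -
      have "0 < w (n - k)" using w_pos n that by simp
      then show ?thesis by (simp add: e_def q_def)
    qed
    have "d n / w n = - 1 / 4 - 2 * (\<Sum>k<K. d k * (d (n - k) / w n)) - M / w n"
      using wn by (subst M) (simp add: diff_divide_distrib add_divide_distrib sum_divide_distrib[symmetric])
    also have "(\<Sum>k<K. d k * (d (n - k) / w n)) =
        (\<Sum>k<K. L * (d k * q n k) + d k * (e (n - k) * q n k))"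
      by (intro sum.cong refl) (simp add: d_eq algebra_simps)
    also have "\<dots> = L * (\<Sum>k<K. d k * q n k) + (\<Sum>k<K. d k * (e (n - k) * q n k))"
      by (simp add: sum.distrib sum_distrib_left)
    \<comment> \<open>Subtracting the fixed-point equation for \<open>L\<close> cancels
      \<open>- 1 / 4\<close> and leaves only the deviation of the truncated sum from
      \<open>S\<close>.\<close>
    finally have "e n = 2 * L * (S - (\<Sum>k<K. d k * q n k))
        - 2 * (\<Sum>k<K. d k * (e (n - k) * q n k)) - M / w n"
      using L by (simp add: e_def algebra_simps)
    then have "\<bar>e n\<bar> \<le> \<bar>2 * L * (S - (\<Sum>k<K. d k * q n k))\<bar>
        + 2 * \<bar>\<Sum>k<K. d k * (e (n - k) * q n k)\<bar> + \<bar>M / w n\<bar>"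
      by linarith
    moreover have "2 * \<bar>\<Sum>k<K. d k * (e (n - k) * q n k)\<bar> \<le> b * (\<Sum>k<K. w k * q n k)"
    proof -
      have "\<bar>\<Sum>k<K. d k * (e (n - k) * q n k)\<bar> \<le> (\<Sum>k<K. \<bar>d k * (e (n - k) * q n k)\<bar>)"
        by (rule sum_abs)
      also have "\<dots> \<le> (\<Sum>k<K. w k / 2 * (b * q n k))"
        unfolding abs_mult using b0
        by (intro sum_mono mult_mono d_le) (auto simp: w_nonneg q_nonneg intro: b)
      also have "\<dots> = b * (\<Sum>k<K. w k * q n k) / 2"
        by (simp add: sum_distrib_left sum_divide_distrib algebra_simps)
      finally show ?thesis by simp
    qed
    moreover have "\<bar>2 * L * (S - (\<Sum>k<K. d k * q n k))\<bar>
        = 2 * \<bar>L\<bar> * \<bar>S - (\<Sum>k<K. d k * q n k)\<bar>"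
      by (simp add: abs_mult)
    ultimately show ?thesis
      using M_le unfolding R_def by linarith
  qed
  \<comment> \<open>Letting first \<open>n\<close> and then \<open>K\<close> tend to infinity sends
    the bound \<open>R b K n\<close> to \<open>b / 2\<close>; the factor \<open>3 / 4\<close> leaves
    room for fixing a finite \<open>K\<close> and then a large \<open>n\<close>.\<close>
  have contraction: "\<forall>\<^sub>F n in sequentially. \<bar>e n\<bar> \<le> 3 / 4 * b"
    if b: "0 < b" and ev: "\<forall>\<^sub>F n in sequentially. \<bar>e n\<bar> \<le> b" for b
  proof -
    have "(\<lambda>K. 2 * \<bar>L\<bar> * \<bar>S - (\<Sum>k<K. d k)\<bar> + b * (\<Sum>k<K. w k)
        + 1 / 4 * (1 - 2 * (\<Sum>k<K. w k)))
      \<longlonglongrightarrow> 2 * \<bar>L\<bar> * \<bar>S - S\<bar> + b * (1 / 2) + 1 / 4 * (1 - 2 * (1 / 2))"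
      using w_sums d_sums unfolding sums_def by (intro tendsto_intros)
    then have "\<forall>\<^sub>F K in sequentially. 2 * \<bar>L\<bar> * \<bar>S - (\<Sum>k<K. d k)\<bar> + b * (\<Sum>k<K. w k)
        + 1 / 4 * (1 - 2 * (\<Sum>k<K. w k)) < 3 / 4 * b"
      by (rule order_tendstoD) (use b in simp)
    then obtain K where K: "2 * \<bar>L\<bar> * \<bar>S - (\<Sum>k<K. d k)\<bar> + b * (\<Sum>k<K. w k)
        + 1 / 4 * (1 - 2 * (\<Sum>k<K. w k)) < 3 / 4 * b"
      by (auto simp: eventually_sequentially)
    obtain N where N: "\<And>n. N \<le> n \<Longrightarrow> \<bar>e n\<bar> \<le> b"
      using ev by (auto simp: eventually_sequentially)
    have "(\<lambda>n. R b K n) \<longlonglongrightarrow> 2 * \<bar>L\<bar> * \<bar>S - (\<Sum>k<K. d k * 1)\<bar> + b * (\<Sum>k<K. w k * 1)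
        + 1 / 4 * (1 - 2 * (\<Sum>k<K. w k * 1))"
      unfolding R_def by (intro tendsto_intros q_lim)
    then have "\<forall>\<^sub>F n in sequentially. R b K n < 3 / 4 * b"
      by (rule order_tendstoD) (use K in simp)
    then show ?thesis
      using eventually_ge_at_top[of "N + 2 * K + 2"]
    proof eventually_elim
      case (elim n)
      have "\<bar>e n\<bar> \<le> R b K n"
        by (rule e_le) (use elim b in \<open>auto intro!: N\<close>)
      then show ?case using elim by simp
    qed
  qed
  \<comment> \<open>Domination by \<open>w\<close> gives a crude first bound, from which the
    contraction is iterated.\<close>
  have e_1: "\<forall>\<^sub>F n in sequentially. \<bar>e n\<bar> \<le> 1 + \<bar>L\<bar>"
    using eventually_ge_at_top[of 1]
  proof eventually_elim
    case (elim n)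
    have "\<bar>d n / w n\<bar> \<le> 1"
      using d_le[of n] w_pos[OF elim] by (simp add: divide_simps)
    then show ?case unfolding e_def by linarith
  qed
  have e_pow: "\<forall>\<^sub>F n in sequentially. \<bar>e n\<bar> \<le> (3 / 4) ^ j * (1 + \<bar>L\<bar>)" for j
  proof (induction j)
    case (Suc j)
    then show ?case using contraction[of "(3 / 4) ^ j * (1 + \<bar>L\<bar>)"] by (simp add: mult.assoc)
  qed (use e_1 in simp)
  have "e \<longlonglongrightarrow> 0"
  proof (rule tendstoI)
    fix \<epsilon> :: real assume "0 < \<epsilon>"
    have "(\<lambda>j. (3 / 4) ^ j * (1 + \<bar>L\<bar>)) \<longlonglongrightarrow> 0 * (1 + \<bar>L\<bar>)"
      by (intro tendsto_intros LIMSEQ_power_zero) auto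
    then have "\<forall>\<^sub>F j in sequentially. (3 / 4) ^ j * (1 + \<bar>L\<bar>) < \<epsilon>"
      by (rule order_tendstoD) (use \<open>0 < \<epsilon>\<close> in simp)
    then obtain j where "(3 / 4) ^ j * (1 + \<bar>L\<bar>) < \<epsilon>"
      by (auto simp: eventually_sequentially)
    with e_pow[of j] show "\<forall>\<^sub>F n in sequentially. dist (e n) 0 < \<epsilon>"
      by (auto elim: eventually_mono)
  qed
  then have "(\<lambda>n. e n + L) \<longlonglongrightarrow> 0 + L"
    by (intro tendsto_intros)
  then show ?thesis by (simp add: e_def L_def)
qed

section \<open>Scaled Catalan numbers\<close>

text \<open>The numbers \<open>C\<^sub>n\<^sub>-\<^sub>1 / 4\<^sup>n\<close>, with generating function \<open>(1 - sqrt (1 - x)) / 2\<close>.\<close>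

definition catalan_weight :: "nat \<Rightarrow> real" where
  "catalan_weight n = (if n = 0 then 0 else - ((- 1) ^ n * (1 / 2 gchoose n)) / 2)"

lemma catalan_weight_0 [simp]: "catalan_weight 0 = 0"
  by (simp add: catalan_weight_def)

lemma catalan_weight_1: "catalan_weight (Suc 0) = 1 / 4"
  by (simp add: catalan_weight_def)

text \<open>This is the absorption identity for generalized binomials. It starts at
  \<open>n = 1\<close> because the value at 0 is set to 0 instead of following the binomial
  formula.\<close>

lemma catalan_weight_Suc:
  assumes "1 \<le> n"
  shows "catalan_weight (Suc n) = catalan_weight n * ((2 * real n - 1) / (2 * real n + 2))"
proof -
  have "real (Suc n) * (1 / 2 gchoose Suc n) = (1 / 2 - real n) * (1 / 2 gchoose n)"
    using gbinomial_mult_1[of "1 / 2 :: real" n] by (simp add: algebra_simps)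
  then have "real (Suc n) * ((- 1) ^ n * (1 / 2 gchoose Suc n)) =
      (1 / 2 - real n) * ((- 1) ^ n * (1 / 2 gchoose n))"
    by (simp add: mult.left_commute)
  moreover have "(- 1) ^ n * (1 / 2 gchoose Suc n) = 2 * catalan_weight (Suc n)"
    by (simp add: catalan_weight_def)
  moreover have "(- 1) ^ n * (1 / 2 gchoose n) = - 2 * catalan_weight n"
    using assms by (simp add: catalan_weight_def)
  ultimately have "real (Suc n) * (2 * catalan_weight (Suc n)) =
      (1 / 2 - real n) * (- 2 * catalan_weight n)"
    by (simp only:)
  then have "catalan_weight (Suc n) * (2 * real n + 2) = catalan_weight n * (2 * real n - 1)"
    by (simp add: algebra_simps)
  then have "catalan_weight (Suc n) = catalan_weight n * (2 * real n - 1) / (2 * real n + 2)"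
    by (simp add: eq_divide_eq)
  then show ?thesis by simp
qed

lemma catalan_weight_pos: "1 \<le> n \<Longrightarrow> 0 < catalan_weight n"
proof (induction n rule: dec_induct)
  case (step n)
  then show ?case by (auto simp: catalan_weight_Suc intro!: mult_pos_pos divide_pos_pos)
qed (simp add: catalan_weight_1)

lemma catalan_weight_nonneg: "0 \<le> catalan_weight n"
  using catalan_weight_pos[of n] by (cases "n = 0") auto

text \<open>The square of \<open>sqrt (1 - x)\<close> is \<open>1 - x\<close>, whose coefficients
  vanish from degree 2 on; on coefficients this is Vandermonde's identity with
  \<open>1 / 2 + 1 / 2 = 1\<close>.\<close>

lemma catalan_weight_conv:
  assumes "2 \<le> n"
  shows "(\<Sum>k\<le>n. catalan_weight k * catalan_weight (n - k)) = catalan_weight n"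
proof -
  define b :: "nat \<Rightarrow> real" where "b k = (- 1) ^ k * (1 / 2 gchoose k)" for k
  have b: "b k = (if k = 0 then 1 else 0) - 2 * catalan_weight k" for k
    by (simp add: catalan_weight_def b_def)
  have "b k * b (n - k) = (- 1) ^ n * ((1 / 2 gchoose k) * (1 / 2 gchoose (n - k)))"
    if "k \<le> n" for k
  proof -
    have "(- 1 :: real) ^ n = (- 1) ^ k * (- 1) ^ (n - k)"
      using that by (simp flip: power_add)
    then show ?thesis by (simp add: b_def)
  qed
  then have "(\<Sum>k\<le>n. b k * b (n - k)) =
      (- 1) ^ n * (\<Sum>k\<in>{0..n}. (1 / 2 gchoose k) * (1 / 2 gchoose (n - k)))"
    by (simp add: sum_distrib_left atMost_atLeast0)
  also have "\<dots> = (- 1) ^ n * ((1 / 2 + 1 / 2 :: real) gchoose n)"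
    by (simp only: gbinomial_Vandermonde)
  also have "((1 / 2 + 1 / 2 :: real) gchoose n) = 0"
    using assms binomial_gbinomial[of 1 n, where 'a = real] by (simp add: binomial_eq_0)
  finally have "0 = (\<Sum>k\<le>n. b k * b (n - k))" by simp
  \<comment> \<open>The constant term of \<open>b\<close> meets the weight of index \<open>n\<close>
    at either end of the convolution, which produces the two linear corrections.\<close>
  also have "\<dots> = (\<Sum>k\<le>n. 4 * (catalan_weight k * catalan_weight (n - k))
      - (if k = 0 then 2 * catalan_weight n else 0) - (if k = n then 2 * catalan_weight n else 0))"
    by (intro sum.cong) (use assms in \<open>auto simp: b algebra_simps\<close>)
  also have "\<dots> = 4 * (\<Sum>k\<le>n. catalan_weight k * catalan_weight (n - k)) - 4 * catalan_weight n"
    by (simp add: sum_subtractf sum_distrib_left)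
  finally show ?thesis by simp
qed

lemma catalan_weight_ratio: "(\<lambda>n. catalan_weight n / catalan_weight (Suc n)) \<longlonglongrightarrow> 1"
proof -
  have "((\<lambda>n. (2 + 2 / real n) / (2 - 1 / real n)) \<longlonglongrightarrow> (2 + 0) / (2 - 0))"
    by (intro tendsto_intros lim_const_over_n) auto
  moreover have "\<forall>\<^sub>F n in sequentially. (2 + 2 / real n) / (2 - 1 / real n)
      = catalan_weight n / catalan_weight (Suc n)"
    using eventually_ge_at_top[of 1]
  proof eventually_elim
    case (elim n)
    then show ?case
      using catalan_weight_pos[OF elim] by (simp add: catalan_weight_Suc field_simps)
  qed
  ultimately show ?thesis by (simp add: tendsto_cong)
qed

text \<open>The remainder is nonnegative, so partial sums are bounded by \<open>1 / 2\<close>; this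
  serves to prove summability.\<close>

lemma catalan_weight_sum:
  "(\<Sum>k\<le>n. catalan_weight k) = 1 / 2 - 2 * real (Suc n) * catalan_weight (Suc n)"
proof (induction n)
  case (Suc n)
  then show ?case
    by (simp add: catalan_weight_Suc[of "Suc n"] divide_simps) (simp add: algebra_simps)
qed (simp add: catalan_weight_1)

lemma convolution_sums:
  fixes f h :: "nat \<Rightarrow> real"
  assumes "\<And>n. 0 \<le> w n" "summable w" "\<And>n. \<bar>f n\<bar> \<le> w n"
  shows "(\<lambda>n. \<Sum>k\<le>n. f k * f (n - k)) sums (suminf f)\<^sup>2"
proof -
  have "summable (\<lambda>n. norm (f n))"
    by (rule summable_comparison_test[OF _ assms(2)]) (use assms in auto)
  then show ?thesis
    using Cauchy_product_sums[of f f] by (simp add: power2_eq_square)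
qed

text \<open>Once summability is known, the convolution identity gives the sum \<open>W\<close> the
  equation \<open>W\<^sup>2 = W - 1 / 4\<close>. Its only root is the double root
  \<open>1 / 2\<close>, so the remainder in the closed form needs no estimate.\<close>

lemma catalan_weight_sums: "catalan_weight sums (1 / 2)"
proof -
  have summable: "summable catalan_weight"
  proof (rule bounded_imp_summable)
    show "(\<Sum>k\<le>n. catalan_weight k) \<le> 1 / 2" for n
      unfolding catalan_weight_sum by (simp add: catalan_weight_nonneg)
  qed (rule catalan_weight_nonneg)
  define W where "W = suminf catalan_weight"
  have "(\<lambda>n. \<Sum>k\<le>n. catalan_weight k * catalan_weight (n - k)) sums W\<^sup>2"
    unfolding W_def by (rule convolution_sums[OF catalan_weight_nonneg summable])
      (simp add: catalan_weight_nonneg)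
  \<comment> \<open>The identity breaks only at \<open>n = 1\<close>, where the convolution is 0 but
    the weight is \<open>1 / 4\<close>.\<close>
  moreover have "(\<Sum>k\<le>n. catalan_weight k * catalan_weight (n - k))
      = catalan_weight n - (if n = 1 then 1 / 4 else 0)" for n
  proof -
    consider "n = 0" | "n = 1" | "2 \<le> n" by linarith
    then show ?thesis
      by cases (auto simp: catalan_weight_conv catalan_weight_1)
  qed
  moreover have "(\<lambda>n. catalan_weight n - (if n = 1 then 1 / 4 else 0)) sums (W - 1 / 4)"
    unfolding W_def by (intro sums_diff summable_sums summable sums_single)
  ultimately have "W\<^sup>2 = W - 1 / 4"
    using sums_unique2 by fastforce
  then have "(W - 1 / 2)\<^sup>2 = 0" by (simp add: power2_eq_square algebra_simps)
  then have "suminf catalan_weight = 1 / 2" by (simp add: W_def)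
  then show ?thesis
    using summable_sums[OF summable] by metis
qed

section \<open>Splitting bracketings and valuations at the root\<close>

lemma eval_less: "(\<And>x. x \<in> set (vars \<phi>) \<Longrightarrow> a x < m) \<Longrightarrow> eval m a \<phi> < m"
proof (induction \<phi>)
  case (Imp \<phi> \<psi>)
  then have "eval m a \<psi> < m" by simp
  then show ?case by (auto simp: godel_imp_def)
qed simp

lemma eval_cong:
  "(\<And>x. x \<in> set (vars \<phi>) \<Longrightarrow> a x = b x) \<Longrightarrow> eval m a \<phi> = eval m b \<phi>"
  by (induction \<phi>) auto

text \<open>Arbitrary variable lists are allowed because the right subformula of a bracketing has
  variables that do not start at 1.\<close>

definition pairs :: "nat \<Rightarrow> nat list \<Rightarrow> nat \<Rightarrow> (formula \<times> (nat \<Rightarrow> nat)) set" where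
  "pairs m xs j = {(\<phi>, a). vars \<phi> = xs \<and> a \<in> set xs \<rightarrow>\<^sub>E {..<m} \<and> eval m a \<phi> = j}"

definition imp_fibre :: "nat \<Rightarrow> nat \<Rightarrow> (nat \<times> nat) set" where
  "imp_fibre m j = {(p, q). p < m \<and> q < m \<and> godel_imp m p q = j}"

lemma finite_imp_fibre: "finite (imp_fibre m j)"
  by (rule finite_subset[of _ "{..<m} \<times> {..<m}"]) (auto simp: imp_fibre_def)

lemma finite_pairs_list: "finite (pairs m xs j)"
proof (rule finite_subset)
  show "finite ({\<phi>. vars \<phi> = xs} \<times> (set xs \<rightarrow>\<^sub>E {..<m}))"
    by (intro finite_cartesian_product finite_vars_eq finite_PiE) auto
qed (auto simp: pairs_def)

lemma g_eq_card_pairs: "g m n j = card (pairs m [1..<Suc n] j)"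
  unfolding g_def pairs_def bracketings_def
  by (simp add: atLeastLessThanSuc_atLeastAtMost del: upt_Suc)

lemma card_pairs_singleton:
  assumes "j < m"
  shows "card (pairs m [x] j) = 1"
proof -
  have "vars \<phi> = [x] \<longleftrightarrow> \<phi> = Var x" for \<phi>
    by (cases \<phi>) (auto simp: append_eq_Cons_conv vars_nonempty)
  then have "pairs m [x] j = {(Var x, a) |a. a \<in> {x} \<rightarrow>\<^sub>E {..<m} \<and> a x = j}"
    by (auto simp: pairs_def)
  also have "\<dots> = {(Var x, \<lambda>y\<in>{x}. j)}"
  proof -
    have "a \<in> {x} \<rightarrow>\<^sub>E {..<m} \<and> a x = j \<longleftrightarrow> a = (\<lambda>y\<in>{x}. j)" for a
      using assms by (auto intro: extensionalityI[of _ "{x}"] simp: PiE_def)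
    then show ?thesis by simp
  qed
  finally show ?thesis by simp
qed

text \<open>Outside \<open>ys\<close> the second valuation takes over. It is already
  \<open>undefined\<close> off its own variables, so the glued map stays extensional.\<close>

definition merge :: "nat list \<Rightarrow> (formula \<times> (nat \<Rightarrow> nat)) \<times> (formula \<times> (nat \<Rightarrow> nat))
    \<Rightarrow> formula \<times> (nat \<Rightarrow> nat)" where
  "merge ys = (\<lambda>((\<alpha>, a), (\<beta>, b)). (Imp \<alpha> \<beta>, \<lambda>x. if x \<in> set ys then a x else b x))"

text \<open>Distinctness makes the two variable sets disjoint, so restricting a valuation to each of
  them inverts the gluing.\<close>

lemma bij_betw_merge:
  assumes "distinct (ys @ zs)"
  shows "bij_betw (merge ys) (\<Union>(p, q)\<in>imp_fibre m j. pairs m ys p \<times> pairs m zs q)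
     {(\<phi>, a). \<exists>\<alpha> \<beta>. \<phi> = Imp \<alpha> \<beta> \<and> vars \<alpha> = ys \<and> vars \<beta> = zs \<and>
        a \<in> set (ys @ zs) \<rightarrow>\<^sub>E {..<m} \<and> eval m a \<phi> = j}" (is "bij_betw _ ?A ?B")
proof (rule bij_betwI')
  fix u v assume u: "u \<in> ?A" and v: "v \<in> ?A"
  obtain \<alpha> a \<beta> b where [simp]: "u = ((\<alpha>, a), (\<beta>, b))" by (metis surj_pair)
  obtain \<alpha>' a' \<beta>' b' where [simp]: "v = ((\<alpha>', a'), (\<beta>', b'))" by (metis surj_pair)
  have a: "a \<in> extensional (set ys)" "a' \<in> extensional (set ys)"
    "b \<in> extensional (set zs)" "b' \<in> extensional (set zs)"
    using u v by (auto simp: pairs_def PiE_def)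
  show "merge ys u = merge ys v \<longleftrightarrow> u = v"
  proof
    assume "merge ys u = merge ys v"
    then have "\<alpha> = \<alpha>'" "\<beta> = \<beta>'"
      and eq: "(\<lambda>x. if x \<in> set ys then a x else b x) = (\<lambda>x. if x \<in> set ys then a' x else b' x)"
      by (simp_all add: merge_def)
    have "a x = a' x" if "x \<in> set ys" for x
      using fun_cong[OF eq, of x] that by simp
    then have "a = a'" by (rule extensionalityI[OF a(1,2)])
    have "b x = b' x" if "x \<in> set zs" for x
    proof -
      have "x \<notin> set ys" using assms that by auto
      then show ?thesis using fun_cong[OF eq, of x] by simp
    qed
    then have "b = b'" by (rule extensionalityI[OF a(3,4)])
    show "u = v"
      by (simp add: \<open>\<alpha> = \<alpha>'\<close> \<open>\<beta> = \<beta>'\<close> \<open>a = a'\<close> \<open>b = b'\<close>)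
  qed simp
next
  fix u assume u: "u \<in> ?A"
  obtain \<alpha> a \<beta> b where [simp]: "u = ((\<alpha>, a), (\<beta>, b))" by (metis surj_pair)
  let ?c = "\<lambda>x. if x \<in> set ys then a x else b x"
  have v: "vars \<alpha> = ys" "vars \<beta> = zs" using u by (auto simp: pairs_def)
  have "eval m ?c \<alpha> = eval m a \<alpha>" "eval m ?c \<beta> = eval m b \<beta>"
    using assms v by (auto intro!: eval_cong)
  moreover have "?c \<in> set (ys @ zs) \<rightarrow>\<^sub>E {..<m}"
    using u by (auto simp: pairs_def PiE_def Pi_def extensional_def)
  moreover have "godel_imp m (eval m a \<alpha>) (eval m b \<beta>) = j"
    using u by (auto simp: pairs_def imp_fibre_def)
  ultimately show "merge ys u \<in> ?B"
    using v by (auto simp: merge_def)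
next
  fix v assume "v \<in> ?B"
  then obtain \<alpha> \<beta> c where v: "v = (Imp \<alpha> \<beta>, c)" "vars \<alpha> = ys" "vars \<beta> = zs"
    "c \<in> set (ys @ zs) \<rightarrow>\<^sub>E {..<m}" "eval m c (Imp \<alpha> \<beta>) = j" by auto
  define a where "a = restrict c (set ys)"
  define b where "b = restrict c (set zs)"
  have e: "eval m c \<alpha> = eval m a \<alpha>" "eval m c \<beta> = eval m b \<beta>"
    using v by (auto intro!: eval_cong simp: a_def b_def)
  have ab: "a \<in> set ys \<rightarrow>\<^sub>E {..<m}" "b \<in> set zs \<rightarrow>\<^sub>E {..<m}"
    using v by (auto simp: a_def b_def)
  have "eval m a \<alpha> < m" "eval m b \<beta> < m"
    using v ab by (auto intro!: eval_less)
  then have "(eval m a \<alpha>, eval m b \<beta>) \<in> imp_fibre m j"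
    using v e by (simp add: imp_fibre_def)
  moreover have "((\<alpha>, a), (\<beta>, b)) \<in> pairs m ys (eval m a \<alpha>) \<times> pairs m zs (eval m b \<beta>)"
    using v ab by (simp add: pairs_def)
  ultimately have "((\<alpha>, a), (\<beta>, b)) \<in> ?A" by blast
  moreover have "c x = (if x \<in> set ys then a x else b x)" for x
    using v(4) by (auto simp: a_def b_def PiE_def extensional_def)
  then have "v = merge ys ((\<alpha>, a), (\<beta>, b))"
    by (auto simp: merge_def v(1))
  ultimately show "\<exists>u\<in>?A. v = merge ys u" by blast
qed

text \<open>With at least two leaves the root is an implication. The number \<open>k\<close> of
  leaves on its left is unique and leaves both sides nonempty; \<open>bij_betw_merge\<close> counts
  each case.\<close>

lemma card_pairs_rec:
  assumes "distinct xs" and "2 \<le> length xs"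
  shows "card (pairs m xs j) = (\<Sum>k = 1..<length xs. \<Sum>(p, q)\<in>imp_fibre m j.
           card (pairs m (take k xs) p) * card (pairs m (drop k xs) q))"
proof -
  define B where "B k = {(\<phi>, a). \<exists>\<alpha> \<beta>. \<phi> = Imp \<alpha> \<beta> \<and> vars \<alpha> = take k xs \<and>
     vars \<beta> = drop k xs \<and> a \<in> set xs \<rightarrow>\<^sub>E {..<m} \<and> eval m a \<phi> = j}" for k
  have "\<exists>k\<in>{1..<length xs}. (\<phi>, a) \<in> B k" if "(\<phi>, a) \<in> pairs m xs j" for \<phi> a
  proof (cases \<phi>)
    case (Var i)
    then show ?thesis using that assms by (auto simp: pairs_def)
  next
    case (Imp \<alpha> \<beta>)
    with that have xs: "xs = vars \<alpha> @ vars \<beta>" by (auto simp: pairs_def)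
    then have "(\<phi>, a) \<in> B (length (vars \<alpha>))"
      using that Imp by (auto simp: pairs_def B_def)
    moreover have "length (vars \<alpha>) \<in> {1..<length xs}"
      using xs vars_nonempty[of \<alpha>] vars_nonempty[of \<beta>] by (auto simp: Suc_le_eq)
    ultimately show ?thesis by blast
  qed
  moreover have "B k \<subseteq> pairs m xs j" for k
    by (auto simp: B_def pairs_def)
  ultimately have eq: "pairs m xs j = (\<Union>k\<in>{1..<length xs}. B k)"
    by (auto 4 4)
  have fin: "finite (B k)" for k
    using finite_subset[OF \<open>B k \<subseteq> pairs m xs j\<close>] finite_pairs_list by blast
  have "card (pairs m xs j) = (\<Sum>k = 1..<length xs. card (B k))"
    unfolding eq
  proof (rule card_UN_disjoint)
    show "\<forall>k\<in>{1..<length xs}. \<forall>l\<in>{1..<length xs}. k \<noteq> l \<longrightarrow> B k \<inter> B l = {}"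
    proof (intro ballI impI)
      fix k l assume kl: "k \<in> {1..<length xs}" "l \<in> {1..<length xs}" "k \<noteq> l"
      have "length (take k xs) \<noteq> length (take l xs)" using kl by simp
      then have "take k xs \<noteq> take l xs" by metis
      then show "B k \<inter> B l = {}" by (auto simp: B_def)
    qed
  qed (auto simp: fin)
  also have "\<dots> = (\<Sum>k = 1..<length xs. \<Sum>(p, q)\<in>imp_fibre m j.
           card (pairs m (take k xs) p) * card (pairs m (drop k xs) q))"
  proof (rule sum.cong)
    fix k
    have "card (B k) =
        card (\<Union>(p, q)\<in>imp_fibre m j. pairs m (take k xs) p \<times> pairs m (drop k xs) q)"
      using bij_betw_same_card[OF bij_betw_merge[of "take k xs" "drop k xs" m j]] assms(1)
      by (simp add: B_def)
    also have "\<dots> = (\<Sum>r\<in>imp_fibre m j.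
        card (case r of (p, q) \<Rightarrow> pairs m (take k xs) p \<times> pairs m (drop k xs) q))"
      by (rule card_UN_disjoint)
        (auto simp: finite_imp_fibre finite_pairs_list, auto simp: pairs_def)
    also have "\<dots> = (\<Sum>(p, q)\<in>imp_fibre m j.
           card (pairs m (take k xs) p) * card (pairs m (drop k xs) q))"
      by (rule sum.cong) (auto simp: card_cartesian_product)
    finally show "card (B k) = \<dots>" .
  qed simp
  finally show ?thesis .
qed

lemma card_pairs_nil: "card (pairs m [] j) = 0"
  by (simp add: pairs_def vars_nonempty)

text \<open>Renaming variables does not change the count, by induction along the root splitting.
  This identifies the counts for later segments with values of \<open>g\<close>.\<close>

lemma card_pairs_eq_length:
  assumes "distinct xs" "distinct ys" "length xs = length ys" "j < m"
  shows "card (pairs m xs j) = card (pairs m ys j)"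
  using assms
proof (induction "length xs" arbitrary: xs ys j rule: less_induct)
  case less
  consider "length xs = 0" | "length xs = 1" | "2 \<le> length xs" by linarith
  then show ?case
  proof cases
    case 1
    then show ?thesis using less.prems by simp
  next
    case 2
    then obtain x y where "xs = [x]" "ys = [y]"
      using less.prems by (metis One_nat_def length_0_conv length_Suc_conv)
    then show ?thesis using less.prems by (simp add: card_pairs_singleton)
  next
    case 3
    have "card (pairs m (take k xs) p) = card (pairs m (take k ys) p)"
      "card (pairs m (drop k xs) p) = card (pairs m (drop k ys) p)"
      if "k \<in> {1..<length xs}" "p < m" for k p
      using less.prems that by (auto intro!: less.hyps)
    then show ?thesis
      using 3 less.prems by (auto simp: card_pairs_rec imp_fibre_def intro!: sum.cong)
  qed
qed

section \<open>Recurrences for the counts\<close>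

lemma g_0: "g m 0 j = 0"
  using card_pairs_nil by (simp add: g_eq_card_pairs)

lemma g_1: "j < m \<Longrightarrow> g m (Suc 0) j = 1"
  by (simp add: g_eq_card_pairs card_pairs_singleton)

lemma g_rec:
  assumes "2 \<le> n" "j < m"
  shows "g m n j = (\<Sum>k = 1..<n. \<Sum>(p, q)\<in>imp_fibre m j. g m k p * g m (n - k) q)"
proof -
  have "card (pairs m (take k [1..<Suc n]) p) = g m k p"
    "card (pairs m (drop k [1..<Suc n]) p) = g m (n - k) p"
    if "k \<in> {1..<n}" "p < m" for k p
    unfolding g_eq_card_pairs using that
    by (auto intro!: card_pairs_eq_length simp del: upt_Suc)
  then show ?thesis
    unfolding g_eq_card_pairs[of m n] using assms
    by (subst card_pairs_rec)
      (auto simp: imp_fibre_def simp del: upt_Suc intro!: sum.cong)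
qed

text \<open>The fibres of the implication partition all pairs of truth values, so summing over
  \<open>j\<close> removes the constraint.\<close>

lemma g_total_rec:
  assumes "2 \<le> n"
  shows "g_total m n = (\<Sum>k = 1..<n. g_total m k * g_total m (n - k))"
proof -
  have "g_total m n = (\<Sum>j<m. \<Sum>k = 1..<n. \<Sum>(p, q)\<in>imp_fibre m j. g m k p * g m (n - k) q)"
    unfolding g_total_def using assms by (simp add: g_rec)
  also have "\<dots> = (\<Sum>k = 1..<n. \<Sum>j<m. \<Sum>(p, q)\<in>imp_fibre m j. g m k p * g m (n - k) q)"
    by (rule sum.swap)
  also have "\<dots> = (\<Sum>k = 1..<n. \<Sum>(p, q)\<in>{..<m} \<times> {..<m}. g m k p * g m (n - k) q)"
  proof (rule sum.cong[OF refl])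
    fix k
    have f: "imp_fibre m j = {x \<in> {..<m} \<times> {..<m}. (\<lambda>(p, q). godel_imp m p q) x = j}" for j
      by (auto simp: imp_fibre_def)
    show "(\<Sum>j<m. \<Sum>(p, q)\<in>imp_fibre m j. g m k p * g m (n - k) q) =
        (\<Sum>(p, q)\<in>{..<m} \<times> {..<m}. g m k p * g m (n - k) q)"
      unfolding f by (rule sum.group) (auto simp: godel_imp_def)
  qed
  also have "\<dots> = (\<Sum>k = 1..<n. g_total m k * g_total m (n - k))"
    by (simp add: g_total_def sum_product sum.cartesian_product)
  finally show ?thesis .
qed

lemma g_bot_rec:
  assumes "2 \<le> n" "2 \<le> m"
  shows "real (g m n 0) =
    (\<Sum>k = 1..<n. (real (g_total m k) - real (g m k 0)) * real (g m (n - k) 0))"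
proof -
  \<comment> \<open>As \<open>2 \<le> m\<close>, the top \<open>m - 1\<close> differs from 0, so
    value 0 can only arise from the branch \<open>p > q\<close> with \<open>q = 0\<close>.\<close>
  have f: "imp_fibre m 0 = {1..<m} \<times> {0}"
    using assms by (auto simp: imp_fibre_def godel_imp_def split: if_splits)
  have "real (g_total m k) - real (g m k 0) = (\<Sum>p = 1..<m. real (g m k p))" for k
    using assms by (simp add: g_total_def lessThan_atLeast0 sum.atLeast_Suc_lessThan)
  then show ?thesis
    using assms by (simp add: g_rec f sum.cartesian_product[symmetric] sum_distrib_right)
qed

lemma g_total_0: "g_total m 0 = 0"
  by (simp add: g_total_def g_0)

lemma g_total_1: "g_total m (Suc 0) = m"
  by (simp add: g_total_def g_1)

lemma sum_atLeastLessThan_eq_atMost: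
  fixes f :: "nat \<Rightarrow> real"
  assumes "f 0 = 0" "f n = 0"
  shows "sum f {1..<n} = sum f {..n}"
proof (rule sum.mono_neutral_left)
  have "k = 0 \<or> k = n" if "k \<in> {..n} - {1..<n}" for k using that by auto
  then show "\<forall>k\<in>{..n} - {1..<n}. f k = 0" using assms by metis
qed auto

text \<open>Both sides satisfy the same convolution recurrence from 2 on, and they agree at 0 and 1
  because \<open>4 * m / 4 = m\<close>.\<close>

lemma g_total_eq:
  assumes "1 \<le> m"
  shows "real (g_total m n) = (4 * real m) ^ n * catalan_weight n"
proof (induction n rule: less_induct)
  case (less n)
  consider "n = 0" | "n = Suc 0" | "2 \<le> n" by linarith
  then show ?case
  proof cases
    case 3
    have "real (g_total m n) = (\<Sum>k = 1..<n. real (g_total m k) * real (g_total m (n - k)))"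
      by (simp add: g_total_rec[OF 3])
    also have "\<dots> = (\<Sum>k = 1..<n. (4 * real m) ^ n * (catalan_weight k * catalan_weight (n - k)))"
    proof (rule sum.cong)
      fix k assume k: "k \<in> {1..<n}"
      then have "(4 * real m) ^ n = (4 * real m) ^ k * (4 * real m) ^ (n - k)"
        by (subst power_add[symmetric]) simp
      then show "real (g_total m k) * real (g_total m (n - k)) =
          (4 * real m) ^ n * (catalan_weight k * catalan_weight (n - k))"
        using k by (simp add: less)
    qed simp
    also have "\<dots> = (\<Sum>k\<le>n. (4 * real m) ^ n * (catalan_weight k * catalan_weight (n - k)))"
      by (rule sum_atLeastLessThan_eq_atMost) simp_all
    also have "\<dots> = (4 * real m) ^ n * catalan_weight n"
      by (simp add: sum_distrib_left[symmetric] catalan_weight_conv[OF 3])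
    finally show ?thesis .
  qed (simp_all add: g_total_0 g_total_1 catalan_weight_1)
qed

section \<open>The limiting proportion of the bottom value\<close>

lemma g_bot_ratio_tendsto:
  assumes m: "2 \<le> m"
  shows "(\<lambda>n. real (g m n 0) / real (g_total m n))
    \<longlonglongrightarrow> 1 / 2 * (1 - sqrt (real m / (real m + 4)))"
proof -
  define w where "w = catalan_weight"
  define \<alpha> where "\<alpha> n = real (g m n 0) / (4 * real m) ^ n" for n
  \<comment> \<open>These are the nonconstant coefficients of \<open>D = A + (1 - G) / 2\<close>,
    scaled to the singularity; the constant term \<open>1 / 2\<close> is dropped, so that
    \<open>d 0 = 0\<close>.\<close>
  define d where "d n = \<alpha> n - w n / 2" for n
  have w: "real (g_total m n) = (4 * real m) ^ n * w n" for n
    using g_total_eq[of m n] m by (simp add: w_def)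
  have \<alpha>: "real (g m n 0) = (4 * real m) ^ n * \<alpha> n" for n
    using m by (simp add: \<alpha>_def)
  have \<alpha>_0: "\<alpha> 0 = 0" and \<alpha>_1: "\<alpha> 1 = 1 / (4 * real m)"
    using m by (simp_all add: \<alpha>_def g_0 g_1)
  have \<alpha>_conv: "\<alpha> n = (\<Sum>k\<le>n. (w k - \<alpha> k) * \<alpha> (n - k))" if n: "2 \<le> n" for n
  proof -
    have "(4 * real m) ^ n * \<alpha> n =
        (\<Sum>k = 1..<n. (real (g_total m k) - real (g m k 0)) * real (g m (n - k) 0))"
      unfolding \<alpha>[symmetric] by (rule g_bot_rec[OF n m])
    also have "\<dots> = (\<Sum>k = 1..<n. (4 * real m) ^ n * ((w k - \<alpha> k) * \<alpha> (n - k)))"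
    proof (rule sum.cong)
      fix k assume k: "k \<in> {1..<n}"
      then have "(4 * real m) ^ n = (4 * real m) ^ k * (4 * real m) ^ (n - k)"
        by (subst power_add[symmetric]) simp
      then show "(real (g_total m k) - real (g m k 0)) * real (g m (n - k) 0) =
          (4 * real m) ^ n * ((w k - \<alpha> k) * \<alpha> (n - k))"
        unfolding w \<alpha> by (simp add: algebra_simps)
    qed simp
    also have "\<dots> = (\<Sum>k\<le>n. (4 * real m) ^ n * ((w k - \<alpha> k) * \<alpha> (n - k)))"
      by (rule sum_atLeastLessThan_eq_atMost) (simp_all add: \<alpha>_0 w_def)
    finally show ?thesis using m by (simp add: sum_distrib_left[symmetric])
  qed
  have \<alpha>_le: "\<alpha> n \<le> w n" "0 \<le> \<alpha> n" for n
  proof -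
    have "g m n 0 \<le> g_total m n"
      unfolding g_total_def by (rule member_le_sum) (use m in auto)
    then have "real (g m n 0) \<le> real (g_total m n)" by simp
    then show "\<alpha> n \<le> w n" using m by (simp add: \<alpha> w)
    show "0 \<le> \<alpha> n" by (simp add: \<alpha>_def)
  qed
  \<comment> \<open>Centring \<open>\<alpha> n\<close>, which lies between 0 and \<open>w n\<close>,
    at the midpoint gives the factor \<open>1 / 2\<close> that the contraction relies on.\<close>
  have d_le: "\<bar>d n\<bar> \<le> w n / 2" for n
    using \<alpha>_le[of n] unfolding d_def by linarith
  have w_nonneg: "0 \<le> w n" for n by (simp add: w_def catalan_weight_nonneg)
  have w_sums: "w sums (1 / 2)" by (simp add: w_def catalan_weight_sums)
  have w_summable: "summable (\<lambda>n. w n / 2)"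
    using sums_divide[OF w_sums] sums_summable by blast
  \<comment> \<open>Completing the square removes the mixed products of \<open>w\<close> and
    \<open>\<alpha>\<close>, up to the symmetry of the convolution.\<close>
  have d_conv: "d n = - w n / 4 - (\<Sum>k\<le>n. d k * d (n - k))" if n: "2 \<le> n" for n
  proof -
    have sym: "(\<Sum>k\<le>n. w (n - k) * \<alpha> k) = (\<Sum>k\<le>n. w k * \<alpha> (n - k))"
      by (rule sum.reindex_bij_witness[of _ "\<lambda>k. n - k" "\<lambda>k. n - k"]) auto
    have "(\<Sum>k\<le>n. d k * d (n - k)) = (\<Sum>k\<le>n. w k * \<alpha> (n - k) / 2 - w (n - k) * \<alpha> k / 2
        - (w k - \<alpha> k) * \<alpha> (n - k) + w k * w (n - k) / 4)"
      by (intro sum.cong) (auto simp: d_def algebra_simps)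
    also have "\<dots> = - \<alpha> n + w n / 4"
      using \<alpha>_conv[OF n] catalan_weight_conv[OF n, folded w_def] sym
      by (simp only: sum.distrib sum_subtractf flip: sum_divide_distrib)
    finally show ?thesis by (simp add: d_def)
  qed
  have "summable d"
    by (rule summable_comparison_test[OF _ w_summable]) (use d_le in auto)
  define S where "S = suminf d"
  have d_sums: "d sums S" using \<open>summable d\<close> by (simp add: S_def summable_sums)
  have S_quad: "S\<^sup>2 + S = 1 / (4 * real m) - 3 / 16"
  proof -
    \<comment> \<open>The recurrence for \<open>d\<close> starts at 2; \<open>c\<close> is
      \<open>w 1 / 4 + d 1\<close>, the correction that makes it hold at 1 as well.\<close>
    define c where "c = 1 / (4 * real m) - 1 / 16"
    have "(\<lambda>n. \<Sum>k\<le>n. d k * d (n - k)) sums S\<^sup>2"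
      unfolding S_def
      by (rule convolution_sums[where w = "\<lambda>n. w n / 2"])
        (use w_nonneg w_summable d_le in auto)
    moreover have "(\<Sum>k\<le>n. d k * d (n - k)) = - w n / 4 - d n + (if n = 1 then c else 0)" for n
    proof -
      consider "n = 0" | "n = 1" | "2 \<le> n" by linarith
      then show ?thesis
      proof cases
        case 3
        then show ?thesis using d_conv[OF 3] by simp
      qed (use \<alpha>_0 \<alpha>_1 catalan_weight_1 in \<open>auto simp: d_def w_def c_def\<close>)
    qed
    moreover have "(\<lambda>n. - w n / 4 - d n + (if n = 1 then c else 0)) sums (- (1 / 2) / 4 - S + c)"
      by (intro sums_add sums_diff sums_divide sums_minus w_sums d_sums sums_single)
    ultimately have "S\<^sup>2 = - (1 / 2) / 4 - S + c"
      by (metis (no_types, lifting) sums_cong sums_unique2)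
    then show ?thesis by (simp add: c_def)
  qed
  \<comment> \<open>The quadratic equation has two roots; this bound selects the one with
    \<open>1 + 2 * S\<close> positive.\<close>
  have "\<bar>S\<bar> \<le> 1 / 4"
  proof -
    have "norm S \<le> (\<Sum>n. w n / 2)"
      unfolding S_def by (rule norm_suminf_le) (use w_summable d_le in auto)
    also have "\<dots> = 1 / 4"
      using sums_unique[OF sums_divide[OF w_sums, of 2]] by simp
    finally show ?thesis by simp
  qed
  then have S_pos: "0 < 1 + 2 * S" by linarith
  have "(1 + 2 * S)\<^sup>2 = 4 * (S\<^sup>2 + S) + 1"
    by (simp add: power2_eq_square algebra_simps)
  also have "\<dots> = (real m + 4) / (4 * real m)"
    unfolding S_quad using m by (simp add: field_simps)
  finally have S_sq: "(1 + 2 * S)\<^sup>2 = (real m + 4) / (4 * real m)" .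
  have "(1 / (2 * (1 + 2 * S)))\<^sup>2 = 1 / (4 * (1 + 2 * S)\<^sup>2)"
    by (simp only: power_divide power_mult_distrib) simp
  also have "\<dots> = real m / (real m + 4)"
    unfolding S_sq using m by (simp add: field_simps)
  finally have S_eq: "1 / (2 * (1 + 2 * S)) = sqrt (real m / (real m + 4))"
    using S_pos by (intro real_sqrt_unique[symmetric]) auto
  have "(\<lambda>n. d n / w n) \<longlonglongrightarrow> - 1 / (4 * (1 + 2 * S))"
  proof (rule convolution_ratio_tendsto[OF _ _ _ w_sums d_le d_conv d_sums S_pos])
    show "0 < w n" if "1 \<le> n" for n
      using that by (simp add: w_def catalan_weight_pos)
    show "(\<Sum>k\<le>n. w k * w (n - k)) = w n" if "2 \<le> n" for n
      using that by (simp add: w_def catalan_weight_conv)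
    show "(\<lambda>n. w n / w (Suc n)) \<longlonglongrightarrow> 1"
      by (simp add: w_def catalan_weight_ratio)
  qed
  \<comment> \<open>Adding \<open>1 / 2\<close> undoes the centring, since
    \<open>\<alpha> n / w n = 1 / 2 + d n / w n\<close>.\<close>
  then have lim: "(\<lambda>n. 1 / 2 + d n / w n) \<longlonglongrightarrow> 1 / 2 + - 1 / (4 * (1 + 2 * S))"
    by (intro tendsto_add tendsto_const)
  have ev: "\<forall>\<^sub>F n in sequentially. 1 / 2 + d n / w n = real (g m n 0) / real (g_total m n)"
    using eventually_ge_at_top[of 1]
  proof eventually_elim
    case (elim n)
    then have "0 < w n" by (simp add: w_def catalan_weight_pos)
    then show ?case using m by (simp add: \<alpha> w d_def diff_divide_distrib)
  qed
  have "1 / 2 + - 1 / (4 * (1 + 2 * S)) = 1 / 2 * (1 - 1 / (2 * (1 + 2 * S)))"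
    by (simp add: algebra_simps)
  then show ?thesis
    using Lim_transform_eventually[OF lim ev] by (simp only: S_eq)
qed

theorem proposition8:
  "(\<forall>m\<ge>2. (\<lambda>n. real (g m n 0) / real (g_total m n)) \<longlonglongrightarrow> p_bot m
          \<and> p_bot m = 1 / 2 * (1 - sqrt (real m / (real m + 4))))
   \<and> p_bot \<sim>[at_top] (\<lambda>m. 1 / real m)"
proof -
  have p_bot: "p_bot m = 1 / 2 * (1 - sqrt (real m / (real m + 4)))" if "2 \<le> m" for m
    unfolding p_bot_def by (rule limI[OF g_bot_ratio_tendsto[OF that]])
  have "(\<lambda>m. 1 / 2 * (1 - sqrt (real m / (real m + 4)))) \<sim>[at_top] (\<lambda>m. 1 / real m)"
    by real_asymp
  \<comment> \<open>The closed form is established only for \<open>2 \<le> m\<close>, which suffices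
    for an asymptotic equivalence.\<close>
  moreover have "\<forall>\<^sub>F m in at_top. 1 / 2 * (1 - sqrt (real m / (real m + 4))) = p_bot m"
    using eventually_ge_at_top[of 2] by eventually_elim (simp add: p_bot)
  ultimately have "p_bot \<sim>[at_top] (\<lambda>m. 1 / real m)"
    by (rule asymp_equiv_transfer) simp_all
  then show ?thesis using g_bot_ratio_tendsto by (simp add: p_bot)
qed

end
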